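(* Every connected locally Ore graph $G$ of order at least $3$ is fully cycle extendable.
   Context: All graphs are finite, simple, and undirected. $n(G)$ is the order of $G$; $N_G(u)$ is the (open) neighborhood and $d_G(u)$ the degree of $u$ in $G$. $G$ is locally Ore if $|N_G(u)\cap N_G(v)|+|N_G(u)\cap N_G(w)|\geq d_G(u)$ for every induced path $vuw$ of order $3$ in $G$ (that is, for all distinct vertices $u,v,w$ with $u$ adjacent to both $v$ and $w$, and $v$ not adjacent to $w$). A cycle $C$ in $G$ is extendable if $G$ contains a cycle $C'$ of order $n(C)+1$ with $V(C)\subseteq V(C')$. $G$ is fully cycle extendable if every vertex of $G$ lies on a triangle and every cycle in $G$ of order less than $n(G)$ is extendable. *)

theory Defs
  imports "Graph_Theory.Digraph_Component" "Graph_Theory.Pair_Digraph"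
begin

text \<open>
  A finite simple undirected graph is a \<open>pair_graph\<close>: a finite vertex set with a symmetric,
  irreflexive arc relation, where the edge \<open>uv\<close> is represented by the two arcs
  \<open>(u, v)\<close> and \<open>(v, u)\<close>.
\<close>

definition neighborhood :: "'a pair_pre_digraph \<Rightarrow> 'a \<Rightarrow> 'a set" where
  "neighborhood G u = {v. (u, v) \<in> parcs G}"

definition degree :: "'a pair_pre_digraph \<Rightarrow> 'a \<Rightarrow> nat" where
  "degree G u = card (neighborhood G u)"

definition locally_Ore :: "'a pair_pre_digraph \<Rightarrow> bool" where
  "locally_Ore G \<longleftrightarrow>
    (\<forall>u \<in> pverts G. \<forall>v \<in> pverts G. \<forall>w \<in> pverts G.
      u \<noteq> v \<and> u \<noteq> w \<and> v \<noteq> w \<and>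
      (u, v) \<in> parcs G \<and> (u, w) \<in> parcs G \<and> (v, w) \<notin> parcs G \<longrightarrow>
      card (neighborhood G u \<inter> neighborhood G v) + card (neighborhood G u \<inter> neighborhood G w)
        \<ge> degree G u)"

text \<open>
  \<open>pre_digraph.cycle\<close> describes a cycle by its list of arcs and also admits the closed walk
  \<open>[(u, v), (v, u)]\<close> along a single undirected edge; the bound on the length rules this out.
\<close>

definition graph_cycle :: "'a pair_pre_digraph \<Rightarrow> ('a \<times> 'a) list \<Rightarrow> bool" where
  "graph_cycle G C \<longleftrightarrow> pre_digraph.cycle (with_proj G) C \<and> 3 \<le> length C"

text \<open>Every vertex of a cycle is the tail of one of its arcs.\<close>

definition cycle_verts :: "('a \<times> 'a) list \<Rightarrow> 'a set" where
  "cycle_verts C = fst ` set C"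

definition extendable :: "'a pair_pre_digraph \<Rightarrow> ('a \<times> 'a) list \<Rightarrow> bool" where
  "extendable G C \<longleftrightarrow>
    (\<exists>C'. graph_cycle G C' \<and> card (cycle_verts C') = card (cycle_verts C) + 1 \<and>
      cycle_verts C \<subseteq> cycle_verts C')"

definition fully_cycle_extendable :: "'a pair_pre_digraph \<Rightarrow> bool" where
  "fully_cycle_extendable G \<longleftrightarrow>
    (\<forall>v \<in> pverts G. \<exists>T. graph_cycle G T \<and> card (cycle_verts T) = 3 \<and> v \<in> cycle_verts T) \<and>
    (\<forall>C. graph_cycle G C \<and> card (cycle_verts C) < card (pverts G) \<longrightarrow> extendable G C)"

end

theory Submission
  imports Defs
begin

text \<open>
  Let \<open>C\<close> be a cycle and \<open>x\<close> a vertex outside \<open>C\<close> with a neighbour on \<open>C\<close>, and suppose that \<open>C\<close> is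
  not extendable. Let \<open>A\<close> be the set of arcs \<open>(a, b)\<close> of \<open>C\<close> with \<open>a\<close> adjacent to \<open>x\<close>. The heads of
  these arcs are not adjacent to \<open>x\<close> and are pairwise non-adjacent, since otherwise \<open>x\<close> could be
  added to \<open>C\<close>. For \<open>(a, b) \<in> A\<close> the local Ore condition at the induced path \<open>x a b\<close> says that
  \<open>a\<close>, \<open>b\<close>, \<open>x\<close> have at least as many common neighbours as \<open>a\<close> has neighbours that are adjacent to
  neither \<open>b\<close> nor \<open>x\<close>. The former are tails of \<open>A\<close>, and the latter include the heads of \<open>A\<close> adjacent
  to \<open>a\<close> as well as \<open>x\<close> itself. So each \<open>b\<close> is adjacent to strictly more tails of \<open>A\<close> than its
  predecessor \<open>a\<close> is adjacent to heads of \<open>A\<close>. Summing over \<open>A\<close> counts the adjacent pairs of a tail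
  and a head on both sides, a contradiction.
\<close>

section \<open>Walks as lists of arcs and as lists of vertices\<close>

lemma pcas_zip: "pcas x (zip (x # xs) (xs @ [y])) y"
  by (induction xs arbitrary: x) auto

lemma pawalk_verts_conv_snd: "pcas u p v \<Longrightarrow> pawalk_verts u p = u # map snd p"
  by (induction p arbitrary: u) auto

lemma pawalk_verts_conv_fst: "pcas u p v \<Longrightarrow> pawalk_verts u p = map fst p @ [v]"
  by (induction p arbitrary: u) auto

lemma pcas_append: "pcas u (p @ q) v \<longleftrightarrow> (\<exists>w. pcas u p w \<and> pcas w q v)"
  by (induction p arbitrary: u) auto

lemma pcas_hd: "pcas u p v \<Longrightarrow> p \<noteq> [] \<Longrightarrow> hd (map fst p) = u"
  by (cases p) auto

lemma successively_pawalk_verts: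
  "pcas u p v \<Longrightarrow> set p \<subseteq> R \<Longrightarrow> successively (\<lambda>x y. (x, y) \<in> R) (pawalk_verts u p)"
  by (induction p arbitrary: u) (auto simp: successively_Cons pawalk_verts_conv_snd)

lemma zip_subset_if_successively:
  "successively (\<lambda>x y. (x, y) \<in> R) (x # xs @ [y]) \<Longrightarrow> set (zip (x # xs) (xs @ [y])) \<subseteq> R"
  by (induction xs arbitrary: x) auto

text \<open>On vertex lists, insertion and reversal of segments are plain list operations, whereas
  reversing a list of arcs would also flip each arc.\<close>

definition vertex_cycle :: "'a pair_pre_digraph \<Rightarrow> 'a list \<Rightarrow> bool" where
  "vertex_cycle G vs \<longleftrightarrow> distinct vs \<and> 3 \<le> length vs \<and>
    successively (\<lambda>x y. (x, y) \<in> parcs G) vs \<and> (last vs, hd vs) \<in> parcs G"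

context pair_graph
begin

section \<open>Translation between the two representations of cycles\<close>

lemma graph_cycle_if_vertex_cycle:
  assumes "vertex_cycle G vs"
  obtains C where "graph_cycle G C" "cycle_verts C = set vs"
proof -
  obtain x xs where vs: "vs = x # xs"
    using assms by (cases vs) (auto simp: vertex_cycle_def)
  \<comment> \<open>Each vertex is paired with its cyclic successor, the last one with
    \<open>x\<close>.\<close>
  define C where "C = zip (x # xs) (xs @ [x])"
  have "successively (\<lambda>x y. (x, y) \<in> parcs G) (x # xs @ [x])"
    using assms unfolding vertex_cycle_def vs
    by (cases "xs = []") (auto simp: successively_append_iff successively_Cons)
  then have sub: "set C \<subseteq> parcs G"
    unfolding C_def by (rule zip_subset_if_successively)
  have cas: "pcas x C x"
    unfolding C_def by (rule pcas_zip)
  have len: "length C = length vs"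
    by (simp add: C_def vs)
  have snd: "map snd C = xs @ [x]" and fst: "map fst C = vs"
    unfolding C_def vs by (auto simp del: zip_Cons_Cons)
  have "C \<noteq> []"
    by (simp add: C_def)
  then have "(x, hd (xs @ [x])) \<in> parcs G"
    using sub by (cases xs) (auto simp: C_def)
  then have "x \<in> pverts G"
    by (rule in_arcsD1)
  moreover have "distinct (tl (pawalk_verts x C))"
    using assms by (simp add: pawalk_verts_conv_snd[OF cas] snd vertex_cycle_def vs)
  ultimately have "cycle C"
    using sub cas \<open>C \<noteq> []\<close> by (auto simp: cycle_def awalk_def)
  then have "graph_cycle G C"
    using assms len by (simp add: graph_cycle_def vertex_cycle_def)
  moreover have "cycle_verts C = set vs"
    using fst by (metis cycle_verts_def list.set_map)
  ultimately show thesis ..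
qed

lemma graph_cycleE:
  assumes "graph_cycle G C"
  obtains u where "pcas u C u" "set C \<subseteq> parcs G" "distinct (map snd C)" "3 \<le> length C"
  using assms by (force simp: graph_cycle_def cycle_def awalk_def pawalk_verts_conv_snd)

text \<open>The tails of a closed walk are its heads up to rotation, so distinctness passes from the
  heads, where \<open>cycle\<close> demands it, to the tails.\<close>

lemma distinct_map_fst_graph_cycle:
  assumes "graph_cycle G C"
  shows "distinct (map fst C)"
proof -
  obtain u where u: "pcas u C u" "distinct (map snd C)"
    using assms by (rule graph_cycleE)
  have "map fst C @ [u] = u # map snd C"
    using u(1) pawalk_verts_conv_fst pawalk_verts_conv_snd by metis
  then have "mset (map fst C @ [u]) = mset (u # map snd C)"
    by (rule arg_cong)
  then have "mset (map fst C) = mset (map snd C)"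
    by simp
  then show ?thesis
    using u(2) by (rule mset_eq_imp_distinct_iff[THEN iffD2])
qed

text \<open>Rotating the arc list until \<open>(a, b)\<close> comes last makes the tails a path from
  \<open>b\<close> to \<open>a\<close>; any other arc is a place where this path can be cut.\<close>

lemma graph_cycle_open:
  assumes C: "graph_cycle G C" and ab: "(a, b) \<in> set C"
  obtains vs where "vertex_cycle G vs" "set vs = cycle_verts C" "hd vs = b" "last vs = a"
    "\<And>c d. (c, d) \<in> set C \<Longrightarrow> (c, d) \<noteq> (a, b) \<Longrightarrow>
      \<exists>p q. vs = p @ q \<and> p \<noteq> [] \<and> q \<noteq> [] \<and> last p = c \<and> hd q = d"
proof -
  obtain u where u: "pcas u C u" "set C \<subseteq> parcs G" "3 \<le> length C"
    using C by (rule graph_cycleE)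
  obtain p1 p2 where split: "C = p1 @ (a, b) # p2"
    using ab by (auto dest: split_list)
  define D where "D = p2 @ p1 @ [(a, b)]"
  have cas: "pcas b D b"
    using u(1) by (auto simp: split D_def pcas_append simp del: cas_append_iff)
  have D: "set D = set C" "length D = length C" "D \<noteq> []"
    by (auto simp: D_def split)
  have "distinct (map fst D)"
    using distinct_map_fst_graph_cycle[OF C] by (auto simp: D_def split)
  moreover have "successively (\<lambda>x y. (x, y) \<in> parcs G) (map fst D @ [b])"
    using successively_pawalk_verts[OF cas] u(2) D by (simp add: pawalk_verts_conv_fst[OF cas])
  moreover have hd: "hd (map fst D) = b"
    using pcas_hd[OF cas] D by simp
  ultimately have "vertex_cycle G (map fst D)"
    using D u(3) by (simp add: vertex_cycle_def successively_append_iff)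
  moreover have "\<exists>p q. map fst D = p @ q \<and> p \<noteq> [] \<and> q \<noteq> [] \<and> last p = c \<and> hd q = d"
    if cd: "(c, d) \<in> set C" "(c, d) \<noteq> (a, b)" for c d
  proof -
    obtain q1 q2 where q: "D = q1 @ (c, d) # q2"
      using cd D(1) by (metis split_list)
    \<comment> \<open>\<open>D\<close> ends with \<open>(a, b)\<close>, so every other arc has a
      successor in \<open>D\<close>.\<close>
    then have "q2 \<noteq> []"
      using cd by (auto simp: D_def)
    moreover have "pcas d q2 b"
      using cas by (auto simp: q pcas_append simp del: cas_append_iff)
    ultimately have "hd (map fst q2) = d"
      using pcas_hd by metis
    then show ?thesis
      using \<open>q2 \<noteq> []\<close> by (intro exI[of _ "map fst (q1 @ [(c, d)])"] exI[of _ "map fst q2"])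
        (simp add: q)
  qed
  moreover have "set (map fst D) = cycle_verts C" "last (map fst D) = a"
    by (auto simp: D_def split cycle_verts_def)
  ultimately show thesis
    using hd that by blast
qed

lemma head_in_cycle_verts:
  assumes "graph_cycle G C" "(a, b) \<in> set C"
  shows "b \<in> cycle_verts C"
proof -
  obtain vs where "set vs = cycle_verts C" "hd vs = b" "vertex_cycle G vs"
    using graph_cycle_open[OF assms] by metis
  then show ?thesis
    using hd_in_set[of vs] by (fastforce simp: vertex_cycle_def)
qed

section \<open>Adding one vertex to a cycle\<close>

lemma extendable_if_vertex_cycle:
  assumes "vertex_cycle G vs" "set vs = insert x (cycle_verts C)" "x \<notin> cycle_verts C"
  shows "extendable G C"
proof -
  obtain C' where "graph_cycle G C'" "cycle_verts C' = set vs"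
    using assms(1) by (rule graph_cycle_if_vertex_cycle)
  moreover have "finite (cycle_verts C)"
    by (simp add: cycle_verts_def)
  ultimately show ?thesis
    using assms unfolding extendable_def by (intro exI[of _ C']) auto
qed

text \<open>Opening the cycle at \<open>(a, b)\<close> leaves a path whose ends \<open>x\<close>
  joins.\<close>

lemma extendable_insert:
  assumes C: "graph_cycle G C" and ab: "(a, b) \<in> set C"
    and x: "x \<notin> cycle_verts C" "(a, x) \<in> parcs G" "(x, b) \<in> parcs G"
  shows "extendable G C"
proof -
  obtain vs where vs: "vertex_cycle G vs" "set vs = cycle_verts C" "hd vs = b" "last vs = a"
    using graph_cycle_open[OF C ab] by metis
  have "vertex_cycle G (x # vs)"
    using vs x by (auto simp: vertex_cycle_def successively_Cons)
  then show ?thesis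
    by (rule extendable_if_vertex_cycle) (use vs x in auto)
qed

text \<open>The path from \<open>b\<close> to \<open>a\<close> is cut into \<open>p\<close> from
  \<open>b\<close> to \<open>c\<close> and \<open>q\<close> from \<open>d\<close> to
  \<open>a\<close>. With \<open>p\<close> reversed, the edge \<open>bd\<close> links the pieces and
  \<open>x\<close> joins the ends \<open>c\<close> and \<open>a\<close>.\<close>

lemma extendable_crossing:
  assumes C: "graph_cycle G C" and ab: "(a, b) \<in> set C" and cd: "(c, d) \<in> set C"
    and x: "x \<notin> cycle_verts C" "(x, a) \<in> parcs G" "(x, c) \<in> parcs G" and bd: "(b, d) \<in> parcs G"
  shows "extendable G C"
proof -
  have "(c, d) \<noteq> (a, b)"
    using bd no_loops' by auto
  with graph_cycle_open[OF C ab] cd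
  obtain vs p q where vs: "vertex_cycle G vs" "set vs = cycle_verts C" "hd vs = b" "last vs = a"
    and pq: "vs = p @ q" "p \<noteq> []" "q \<noteq> []" "last p = c" "hd q = d"
    by metis
  have "successively (\<lambda>x y. (x, y) \<in> parcs G) p"
    using vs(1) by (simp add: vertex_cycle_def pq successively_append_iff)
  then have "successively (\<lambda>x y. (y, x) \<in> parcs G) p"
    by (rule successively_mono) (simp add: arcs_symmetric)
  then have "vertex_cycle G (x # rev p @ q)"
    using vs x bd pq arcs_symmetric
    by (auto simp: vertex_cycle_def successively_Cons successively_append_iff hd_rev last_rev)
  then show ?thesis
    by (rule extendable_if_vertex_cycle) (use vs pq x in auto)
qed

section \<open>Consequences of the Ore condition and of connectedness\<close>

lemma finite_neighborhood [simp]: "finite (neighborhood G u)"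
  by (rule finite_subset[OF _ pair_finite_verts]) (auto simp: neighborhood_def in_arcsD2)

text \<open>By inclusion-exclusion, the sum in the Ore condition counts the neighbours of
  \<open>u\<close> adjacent to \<open>v\<close> or \<open>w\<close>, plus once more those adjacent
  to both.\<close>

lemma locally_Ore_common_neighbors:
  assumes "locally_Ore G" "(u, v) \<in> parcs G" "(u, w) \<in> parcs G" "(v, w) \<notin> parcs G" "v \<noteq> w"
  shows "card (neighborhood G u - (neighborhood G v \<union> neighborhood G w))
    \<le> card (neighborhood G u \<inter> neighborhood G v \<inter> neighborhood G w)"
proof -
  let ?U = "neighborhood G u" and ?V = "neighborhood G v" and ?W = "neighborhood G w"
  have "u \<noteq> v" "u \<noteq> w" "u \<in> pverts G" "v \<in> pverts G" "w \<in> pverts G"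
    using assms no_loops' in_arcsD1 in_arcsD2 by blast+
  then have "card ?U \<le> card (?U \<inter> ?V) + card (?U \<inter> ?W)"
    using assms unfolding locally_Ore_def degree_def by blast
  also have "\<dots> = card (?U \<inter> (?V \<union> ?W)) + card (?U \<inter> ?V \<inter> ?W)"
    using card_Un_Int[of "?U \<inter> ?V" "?U \<inter> ?W"] by (simp add: Int_Un_distrib Int_ac)
  finally have "card ?U \<le> \<dots>" .
  moreover have "card ?U = card (?U \<inter> (?V \<union> ?W)) + card (?U - (?V \<union> ?W))"
    by (metis Int_Diff_Un Int_Diff_disjoint card_Un_disjoint finite_Diff finite_Int
        finite_neighborhood)
  ultimately show ?thesis
    by linarith
qed

lemma arc_leaving:
  assumes "connected (with_proj G)" "S \<subset> pverts G" "S \<noteq> {}"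
  obtains a b where "(a, b) \<in> parcs G" "a \<in> S" "b \<notin> S"
proof -
  obtain s t where st: "s \<in> S" "t \<in> pverts G" "t \<notin> S" "s \<in> pverts G"
    using assms by blast
  have "strongly_connected (with_proj G)"
    using symmetric_connected_imp_strongly_connected[OF sym_arcs assms(1)] .
  then have "s \<rightarrow>\<^sup>*\<^bsub>with_proj G\<^esub> t"
    using st by (auto simp: strongly_connected_def)
  then have "\<exists>a b. (a, b) \<in> parcs G \<and> a \<in> S \<and> b \<notin> S"
    using st(1,3)
  proof (induction rule: reachable_induct)
    case (step y z)
    then show ?case by auto
  qed simp
  then show thesis
    using that by blast
qed

text \<open>Either the path closes to a triangle, or a common neighbour of all three vertices gives
  two triangles that together cover it.\<close>

lemma triangle_if_path:
  assumes "locally_Ore G" "(u, v) \<in> parcs G" "(u, w) \<in> parcs G" "v \<noteq> w" "z \<in> {u, v, w}"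
  shows "\<exists>T. graph_cycle G T \<and> card (cycle_verts T) = 3 \<and> z \<in> cycle_verts T"
proof -
  have tri: ?thesis
    if "(p, q) \<in> parcs G" "(q, r) \<in> parcs G" "(r, p) \<in> parcs G" "z \<in> {p, q, r}"
    for p q r
  proof -
    have "vertex_cycle G [p, q, r]"
      using that no_loops' by (auto simp: vertex_cycle_def)
    then obtain T where "graph_cycle G T" "cycle_verts T = set [p, q, r]"
      by (rule graph_cycle_if_vertex_cycle)
    moreover have "card (set [p, q, r]) = 3"
      using \<open>vertex_cycle G [p, q, r]\<close> by (simp add: vertex_cycle_def)
    ultimately show ?thesis
      using that(4) by auto
  qed
  show ?thesis
  proof (cases "(v, w) \<in> parcs G")
    case True
    then show ?thesis
      using tri[of u v w] assms arcs_symmetric by blast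
  next
    case False
    \<comment> \<open>Without loops, \<open>v\<close> is not its own neighbour, so the smaller side
      of the Ore bound is already positive.\<close>
    have "v \<in> neighborhood G u - (neighborhood G v \<union> neighborhood G w)"
      using assms False no_loops' arcs_symmetric by (auto simp: neighborhood_def)
    then have "0 < card (neighborhood G u - (neighborhood G v \<union> neighborhood G w))"
      by (auto simp: card_gt_0_iff)
    then have "0 < card (neighborhood G u \<inter> neighborhood G v \<inter> neighborhood G w)"
      using locally_Ore_common_neighbors[OF assms(1-3) False assms(4)] by linarith
    then obtain y where "(u, y) \<in> parcs G" "(v, y) \<in> parcs G" "(w, y) \<in> parcs G"
      by (auto simp: card_gt_0_iff neighborhood_def)
    then show ?thesis
      using tri[of u v y] tri[of u w y] assms arcs_symmetric by blast
  qed
qed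

text \<open>Leaving first \<open>{z}\<close> and then \<open>{z, y}\<close> gives a path of order 3
  through \<open>z\<close>, centred at \<open>z\<close> or at \<open>y\<close>.\<close>

lemma vertex_on_triangle:
  assumes "connected (with_proj G)" "card (pverts G) \<ge> 3" "locally_Ore G" "z \<in> pverts G"
  shows "\<exists>T. graph_cycle G T \<and> card (cycle_verts T) = 3 \<and> z \<in> cycle_verts T"
proof -
  have "card {z} < card (pverts G)"
    using assms by simp
  then have "{z} \<noteq> pverts G"
    by (metis less_irrefl)
  then obtain y where y: "(z, y) \<in> parcs G" "y \<noteq> z"
    using arc_leaving[OF assms(1), of "{z}"] assms(4) by auto
  have "card {z, y} < card (pverts G)"
    using assms y by simp
  moreover have "{z, y} \<subseteq> pverts G"
    using assms(4) y in_arcsD2 by auto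
  ultimately have "{z, y} \<subset> pverts G"
    by (metis less_irrefl psubsetI)
  then obtain a x where x: "(a, x) \<in> parcs G" "a \<in> {z, y}" "x \<notin> {z, y}"
    using arc_leaving[OF assms(1), of "{z, y}"] by blast
  show ?thesis
  proof (cases "a = z")
    case True
    then show ?thesis
      using triangle_if_path[OF assms(3), of z y x z] x y by blast
  next
    case False
    then show ?thesis
      using triangle_if_path[OF assms(3), of y z x z] x y arcs_symmetric by blast
  qed
qed

section \<open>Double counting on a non-extendable cycle\<close>

lemma extendable_if_locally_Ore:
  assumes ore: "locally_Ore G" and C: "graph_cycle G C"
    and x: "x \<notin> cycle_verts C" and y: "y \<in> cycle_verts C" "(y, x) \<in> parcs G"
  shows "extendable G C"
proof (rule ccontr)
  assume nonext: "\<not> extendable G C"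
  define A where "A = {e \<in> set C. (fst e, x) \<in> parcs G}"
  have A: "finite A" "A \<noteq> {}" "A \<subseteq> set C"
    using y by (auto simp: A_def cycle_verts_def)
  have inj: "inj_on snd (set C)"
    using C by (auto elim: graph_cycleE simp: distinct_map)
  have CG: "set C \<subseteq> parcs G"
    using C by (auto elim: graph_cycleE)
  have head_nonadj: "(x, snd e) \<notin> parcs G" if "e \<in> A" for e
    using extendable_insert[OF C _ x, of "fst e" "snd e"] that nonext by (auto simp: A_def)
  have heads_indep: "(snd e, snd f) \<notin> parcs G" if "e \<in> A" "f \<in> A" for e f
    using extendable_crossing[OF C _ _ x, of "fst e" "snd e" "fst f" "snd f"] that nonext
    by (auto simp: A_def arcs_symmetric)
  have excess: "card {f \<in> A. (fst e, snd f) \<in> parcs G} + 1 \<le> card {f \<in> A. (fst f, snd e) \<in> parcs G}"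
    if e: "e \<in> A" for e
  proof -
    obtain a b where ab: "e = (a, b)"
      by (cases e)
    have abC: "(a, b) \<in> set C" "(a, x) \<in> parcs G" "(a, b) \<in> parcs G" "(x, b) \<notin> parcs G"
      using e CG head_nonadj[OF e] by (auto simp: A_def ab)
    \<comment> \<open>Heads of \<open>A\<close> lie on the cycle and \<open>x\<close> does not, so
      \<open>x\<close> is a further neighbour of \<open>a\<close> beside them: the source of the
      \<open>+ 1\<close>.\<close>
    have snd_ne: "x \<noteq> snd f" if "f \<in> A" for f
      using head_in_cycle_verts[OF C, of "fst f" "snd f"] x that by (auto simp: A_def)
    then have "x \<noteq> b"
      using e ab by force
    let ?F = "{f \<in> A. (a, snd f) \<in> parcs G}" and ?B = "{f \<in> A. (fst f, b) \<in> parcs G}"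
    have "x \<notin> snd ` ?F"
      using snd_ne by blast
    moreover have "card (snd ` ?F) = card ?F"
      by (rule card_image) (use inj A in \<open>auto intro: inj_on_subset\<close>)
    ultimately have "card ?F + 1 = card (insert x (snd ` ?F))"
      using A by simp
    also have "\<dots> \<le> card (neighborhood G a - (neighborhood G x \<union> neighborhood G b))"
    proof (rule card_mono)
      have "(x, x) \<notin> parcs G" "(b, x) \<notin> parcs G"
        using abC no_loops' arcs_symmetric by blast+
      moreover have "(x, snd f) \<notin> parcs G \<and> (b, snd f) \<notin> parcs G" if "f \<in> ?F" for f
        using head_nonadj[of f] heads_indep[OF e, of f] that by (simp add: ab)
      ultimately show
        "insert x (snd ` ?F) \<subseteq> neighborhood G a - (neighborhood G x \<union> neighborhood G b)"
        using abC by (auto simp: neighborhood_def)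
    qed simp
    also have "\<dots> \<le> card (neighborhood G a \<inter> neighborhood G x \<inter> neighborhood G b)"
      by (rule locally_Ore_common_neighbors) (use ore abC \<open>x \<noteq> b\<close> in auto)
    also have "\<dots> \<le> card (fst ` ?B)"
    proof (rule card_mono)
      show "neighborhood G a \<inter> neighborhood G x \<inter> neighborhood G b \<subseteq> fst ` ?B"
      proof
        fix w assume "w \<in> neighborhood G a \<inter> neighborhood G x \<inter> neighborhood G b"
        then have w: "(a, w) \<in> parcs G" "(x, w) \<in> parcs G" "(b, w) \<in> parcs G"
          by (auto simp: neighborhood_def)
        \<comment> \<open>Otherwise \<open>w\<close> could be inserted between \<open>a\<close> and
          \<open>b\<close>. On the cycle and adjacent to \<open>x\<close>, it is the tail of an arc
          in \<open>A\<close>.\<close>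
        then have "w \<in> cycle_verts C"
          using extendable_insert[OF C abC(1), of w] nonext arcs_symmetric by blast
        then show "w \<in> fst ` ?B"
          using w by (auto simp: A_def cycle_verts_def arcs_symmetric)
      qed
    qed (use A in simp)
    also have "\<dots> \<le> card ?B"
      using A by (simp add: card_image_le)
    finally show ?thesis
      by (simp add: ab)
  qed
  have "(\<Sum>e\<in>A. card {f \<in> A. (fst e, snd f) \<in> parcs G})
      = (\<Sum>e\<in>A. card {f \<in> A. (fst f, snd e) \<in> parcs G})"
    using sum.swap_restrict[OF A(1) A(1), of "\<lambda>_ _. 1::nat" "\<lambda>e f. (fst e, snd f) \<in> parcs G"]
    by simp
  \<comment> \<open>Summing keeps the inequality strict because \<open>A\<close> contains the arc
    with tail \<open>y\<close>.\<close>
  moreover have "(\<Sum>e\<in>A. card {f \<in> A. (fst e, snd f) \<in> parcs G})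
      < (\<Sum>e\<in>A. card {f \<in> A. (fst f, snd e) \<in> parcs G})"
    using A excess by (intro sum_strict_mono) (auto simp: Suc_le_eq)
  ultimately show False
    by simp
qed

end

theorem corollary10:
  fixes G :: "'a pair_pre_digraph"
  assumes "pair_graph G"
    and "connected (with_proj G)"
    and "card (pverts G) \<ge> 3"
    and "locally_Ore G"
  shows "fully_cycle_extendable G"
proof -
  interpret pair_graph G by fact
  have "extendable G C" if C: "graph_cycle G C" "card (cycle_verts C) < card (pverts G)" for C
  proof -
    have "set C \<subseteq> parcs G" "C \<noteq> []"
      using C(1) by (auto elim: graph_cycleE)
    then have "cycle_verts C \<subset> pverts G" "cycle_verts C \<noteq> {}"
      using C(2) by (force simp: cycle_verts_def dest: arc_fst_in_verts)+
    \<comment> \<open>Connectedness supplies a vertex \<open>x\<close> off the cycle with a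
      neighbour on it.\<close>
    then obtain y x where "(y, x) \<in> parcs G" "y \<in> cycle_verts C" "x \<notin> cycle_verts C"
      using arc_leaving assms(2) by metis
    then show ?thesis
      using extendable_if_locally_Ore assms(4) C(1) by metis
  qed
  then show ?thesis
    using vertex_on_triangle assms(2-4) by (simp add: fully_cycle_extendable_def)
qed

end
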